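(* Let $\mathcal{T}\in\mathbb{R}^{n_1\times n_2\times n_3}$ satisfy $\mathcal{T}=(U_1^{\#},U_2^{\#},U_3^{\#}).\mathcal{G}^{\#}$ where $U_i^{\#}\in\mathbb{R}^{n_i\times r_i}_+$ with $(U_i^{\#})^\top e=e$ for $i\in\{1,2,3\}$ and $\mathcal{G}^{\#}\in\mathbb{R}^{r_1\times r_2\times r_3}$. Assume that $\sqrt{r_3}\le r=r_1=r_2$, that $U_i^{\#}$ satisfies the SSC for $i\in\{1,2,3\}$, that $\operatorname{rank}(\mathcal{G}^{\#}_{(3)})=r_3$, and that the set $\mathcal{V}^{(3)}=\{\sum_{k=1}^{r_3}v_k\mathcal{G}^{\#(3)}_k : v_k\ge0\}$ contains a matrix of rank $r$, where $\mathcal{G}^{\#(3)}_k$ is the $k$-th slice of $\mathcal{G}^{\#}$ along the third mode. Consider the following procedure: 1. Pick $\alpha^{(1)},\dots,\alpha^{(n_3)}\in\mathbb{R}^{n_3}$ independently at random from a continuous distribution, let $A\in\mathbb{R}^{n_3\times n_3}$ be the matrix with columns $\alpha^{(1)},\dots,\alpha^{(n_3)}$, and let $\mathcal{T}_{\alpha^{(i)}}=\sum_{j=1}^{n_3}\alpha^{(i)}_j\mathcal{T}^{(3)}_j$ for $i\in\{1,\dots,n_3\}$. 2. Let $(U_1^*,U_2^*,S_1^* )$ be an optimal solution of $$\min_{U_1\in\mathbb{R}^{n_1\times r},\,U_2\in\mathbb{R}^{n_2\times r},\,S_1\in\mathbb{R}^{r\times r}}|\det(S_1)|\ \text{ such that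 }\ \mathcal{T}_{\alpha^{(1)}}=U_1S_1U_2^\top,\ U_i^\top e=e,\ U_i\ge0\text{ for }i\in\{1,2\}.$$ 3. Let $S^*\in\mathbb{R}^{r^2\times n_3}$ be the matrix whose $i$-th column is $\operatorname{vec}\big((U_1^* )^\dagger\mathcal{T}_{\alpha^{(i)}}((U_2^* )^\top)^\dagger\big)$, and let $(\mathcal{G}_{(3)}^*,U_3^* )$ be an optimal solution of $$\min_{\mathcal{G}_{(3)}\in\mathbb{R}^{r^2\times r_3},\,U_3\in\mathbb{R}^{n_3\times r_3}}\det(\mathcal{G}_{(3)}^\top\mathcal{G}_{(3)})\ \text{ such that }\ S^*A^{-1}=\mathcal{G}_{(3)}U_3^\top,\ U_3^\top e=e,\ U_3\ge0;$$ let $\mathcal{G}^*\in\mathbb{R}^{r\times r\times r_3}$ be the tensor with third-mode unfolding $\mathcal{G}^*_{(3)}$. Then, with probability $1$, for any decomposition $(U_1^*,U_2^*,U_3^* ).\mathcal{G}^*$ obtained with this procedure, there exist permutation matrices $\Pi_1,\Pi_2,\Pi_3$ such that $U_i^{\#}=U_i^*\Pi_i$ for all $i\in\{1,2,3\}$ and $\mathcal{G}^{\#}=(\Pi_1^\top,\Pi_2^\top,\Pi_3^\top).\mathcal{G}^*$.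
   Context: $e$ is the all-ones vector of appropriate dimension, $e_k$ the $k$-th standard basis vector, $\ge$ is entrywise, $U^\dagger$ denotes the Moore-Penrose inverse, and $\operatorname{vec}$ vectorizes a matrix columnwise. A continuous distribution on $\mathbb{R}^n$ means one that is absolutely continuous with respect to Lebesgue measure. For matrices $U_i\in\mathbb{R}^{n_i\times r_i}$ and $\mathcal{G}\in\mathbb{R}^{r_1\times r_2\times r_3}$, the tensor $(U_1,U_2,U_3).\mathcal{G}\in\mathbb{R}^{n_1\times n_2\times n_3}$ has entries $\sum_{i_1,i_2,i_3}(U_1)_{j_1,i_1}(U_2)_{j_2,i_2}(U_3)_{j_3,i_3}\mathcal{G}_{i_1,i_2,i_3}$. The $k$-th slice along the third mode of $\mathcal{T}\in\mathbb{R}^{n_1\times n_2\times n_3}$ is $\mathcal{T}^{(3)}_k\in\mathbb{R}^{n_1\times n_2}$ with $(\mathcal{T}^{(3)}_k)_{i,j}=\mathcal{T}_{i,j,k}$. The third-mode unfolding is $\mathcal{T}_{(3)}\in\mathbb{R}^{n_1n_2\times n_3}$ with $(\mathcal{T}_{(3)})_{(i,j),k}=\mathcal{T}_{i,j,k}$, where $(i,j)$ stands for the index $i+(j-1)n_1$. For $A\in\mathbb{R}^{m\times n}$, $\operatorname{cone}(A)=\{Ay : y\in\mathbb{R}^n, y\ge 0\}$ and $\operatorname{cone}^*(A)=\{y\in\mathbb{R}^m : A^\top y\ge 0\}$. A matrix $H\in\mathbb{R}^{n\times r}_+$ with $r\ge2$ satisfies the sufficiently scattered condition (SSC) if: (SSC1)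 $\{x\in\mathbb{R}^r_+ : e^\top x\ge\sqrt{r-1}\,\|x\|_2\}\subseteq\operatorname{cone}(H^\top)$; and (SSC2) $\operatorname{cone}^*(H^\top)\cap\operatorname{bd}(\mathcal{C}^* )=\{\lambda e_k : \lambda\ge0,\ k\in\{1,\dots,r\}\}$, where $\mathcal{C}^*=\{x\in\mathbb{R}^r : e^\top x\ge\|x\|_2\}$ and $\operatorname{bd}$ denotes the boundary. *)

theory Defs
  imports "HOL-Probability.Probability"
begin

text \<open>
  An \<open>m \<times> n\<close> matrix is an element of \<^typ>\<open>real^'n^'m\<close>, and an \<open>n1 \<times> n2 \<times> n3\<close> tensor an element of
  \<^typ>\<open>real^'n3^'n2^'n1\<close> with entries \<open>T $ i $ j $ k\<close>.  The order on these types is the entrywise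
  one, so \<open>0 \<le> U\<close> says that \<open>U\<close> has nonnegative entries; the all-ones vector is \<^term>\<open>1 :: real^'n\<close>.
\<close>

section \<open>Moore-Penrose inverse\<close>

definition is_pinv :: "real^'n^'m \<Rightarrow> real^'m^'n \<Rightarrow> bool" where
  "is_pinv A X \<longleftrightarrow> A ** X ** A = A \<and> X ** A ** X = X \<and>
     transpose (A ** X) = A ** X \<and> transpose (X ** A) = X ** A"

definition pinv :: "real^'n^'m \<Rightarrow> real^'m^'n" where
  "pinv A = (THE X. is_pinv A X)"

lemma is_pinv_unique:
  assumes "is_pinv A X" "is_pinv A Y"
  shows "X = Y"
proof -
  have X: "A ** X ** A = A" "X ** A ** X = X" "transpose (A ** X) = A ** X"
    "transpose (X ** A) = X ** A"
    and Y: "A ** Y ** A = A" "Y ** A ** Y = Y" "transpose (A ** Y) = A ** Y"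
    "transpose (Y ** A) = Y ** A"
    using assms unfolding is_pinv_def by blast+
  have "A ** X = transpose (A ** Y ** A ** X)" using X(3) Y(1) by simp
  also have "\<dots> = transpose (A ** X) ** transpose (A ** Y)"
    by (simp add: matrix_transpose_mul matrix_mul_assoc)
  also have "\<dots> = A ** X ** A ** Y" by (simp add: X(3) Y(3) matrix_mul_assoc)
  also have "\<dots> = A ** Y" using X(1) by simp
  finally have l: "A ** X = A ** Y" .
  have "X ** A = transpose (X ** A ** Y ** A)"
    using X(4) Y(1) by (metis matrix_mul_assoc)
  also have "\<dots> = transpose (Y ** A) ** transpose (X ** A)"
    by (simp add: matrix_transpose_mul matrix_mul_assoc)
  also have "\<dots> = Y ** (A ** X ** A)" by (simp add: X(4) Y(4) matrix_mul_assoc)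
  also have "\<dots> = Y ** A" using X(1) by simp
  finally have r: "X ** A = Y ** A" .
  show ?thesis using X(2) Y(2) l r by (metis matrix_mul_assoc)
qed

lemma generalized_inverse_exists:
  fixes A :: "real^'n^'m"
  obtains G :: "real^'m^'n" where "A ** G ** A = A"
proof -
  obtain g where g: "linear g" "\<And>v. v \<in> range ((*v) A) \<Longrightarrow> A *v g v = v"
    using linear_exists_right_inverse_on[OF matrix_vector_mul_linear[of A] subspace_UNIV]
    by blast
  have "(A ** matrix g ** A) *v x = A *v x" for x
    using g by (simp add: matrix_vector_mul_assoc[symmetric] matrix_works)
  hence "A ** matrix g ** A = A" by (simp add: matrix_eq)
  thus ?thesis by (rule that)
qed

lemma gram_cancel:
  fixes A :: "real^'n^'m" and X Y :: "real^'k^'n"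
  assumes "transpose A ** A ** X = transpose A ** A ** Y"
  shows "A ** X = A ** Y"
proof -
  have "(A ** X) *v v = (A ** Y) *v v" for v
  proof -
    define z where "z = X *v v - Y *v v"
    have "transpose A *v (A *v z) = 0"
      using assms unfolding z_def
      by (simp add: matrix_vector_mult_diff_distrib matrix_vector_mul_assoc matrix_mul_assoc)
    hence "(A *v z) \<bullet> (A *v z) = 0"
      by (metis dot_lmul_matrix inner_zero_right inner_commute transpose_matrix_vector)
    thus ?thesis
      by (simp add: z_def matrix_vector_mult_diff_distrib matrix_vector_mul_assoc)
  qed
  thus ?thesis by (simp add: matrix_eq)
qed

lemma least_squares_inverse_exists:
  fixes A :: "real^'n^'m"
  obtains B :: "real^'m^'n" where "A ** B ** A = A" "transpose (A ** B) = A ** B"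
proof -
  obtain G where G: "(transpose A ** A) ** G ** (transpose A ** A) = transpose A ** A"
    by (rule generalized_inverse_exists)
  have GT: "(transpose A ** A) ** transpose G ** (transpose A ** A) = transpose A ** A"
    using arg_cong[OF G, of transpose] by (simp add: matrix_transpose_mul matrix_mul_assoc)
  have 1: "A ** (G ** (transpose A ** A)) = A ** mat 1"
    by (rule gram_cancel) (use G in \<open>simp add: matrix_mul_assoc\<close>)
  have 2: "A ** (transpose G ** (transpose A ** A)) = A ** mat 1"
    by (rule gram_cancel) (use GT in \<open>simp add: matrix_mul_assoc\<close>)
  let ?P = "A ** (G ** transpose A)"
  have P: "transpose ?P = A ** transpose G ** transpose A"
    by (simp add: matrix_transpose_mul matrix_mul_assoc)
  have "transpose ?P ** ?P = (A ** (transpose G ** (transpose A ** A))) ** G ** transpose A"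
    unfolding P by (simp add: matrix_mul_assoc)
  hence PP: "transpose ?P ** ?P = ?P" unfolding 2 by (simp add: matrix_mul_assoc)
  have "transpose ?P = transpose (transpose ?P ** ?P)" by (simp only: PP)
  also have "\<dots> = transpose ?P ** ?P" by (simp only: matrix_transpose_mul transpose_transpose)
  finally have "transpose ?P = ?P" by (simp only: PP)
  moreover have "A ** (G ** transpose A) ** A = A" using 1 by (simp add: matrix_mul_assoc)
  ultimately show ?thesis using that by blast
qed

lemma is_pinv_pinv: "is_pinv A (pinv A)"
proof -
  obtain B where B: "A ** B ** A = A" "transpose (A ** B) = A ** B"
    by (rule least_squares_inverse_exists)
  obtain C where C: "transpose A ** C ** transpose A = transpose A"
      "transpose (transpose A ** C) = transpose A ** C"
    by (rule least_squares_inverse_exists)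
  let ?D = "transpose C"
  have D: "A ** ?D ** A = A" "transpose (?D ** A) = ?D ** A"
    using arg_cong[OF C(1), of transpose] C(2)
    by (simp_all add: matrix_transpose_mul matrix_mul_assoc)
  let ?X = "?D ** A ** B"
  have "A ** ?X = A ** B" using D(1) by (simp add: matrix_mul_assoc)
  moreover have "?X ** A = ?D ** A" using B(1) by (metis matrix_mul_assoc)
  moreover have "?D ** A ** ?X = ?X" using D(1) by (metis matrix_mul_assoc)
  ultimately have "is_pinv A ?X" unfolding is_pinv_def using B D by simp
  thus ?thesis unfolding pinv_def using is_pinv_unique by (metis theI)
qed

lemma pinv_eqI: "is_pinv A X \<Longrightarrow> pinv A = X"
  using is_pinv_pinv is_pinv_unique by blast

section \<open>Sufficiently scattered condition\<close>

definition mat_cone :: "real^'n^'m \<Rightarrow> (real^'m) set" where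
  "mat_cone A = {A *v y | y. 0 \<le> y}"

definition mat_dual_cone :: "real^'n^'m \<Rightarrow> (real^'m) set" where
  "mat_dual_cone A = {y. 0 \<le> transpose A *v y}"

definition SSC :: "real^'r^'n \<Rightarrow> bool" where
  "SSC H \<longleftrightarrow> 2 \<le> CARD('r) \<and> 0 \<le> H \<and>
     {x. 0 \<le> x \<and> 1 \<bullet> x \<ge> sqrt (real CARD('r) - 1) * norm x} \<subseteq> mat_cone (transpose H) \<and>
     mat_dual_cone (transpose H) \<inter> frontier {x. 1 \<bullet> x \<ge> norm x} =
       {l *\<^sub>R axis k 1 | l k. 0 \<le> l}"

section \<open>Tensors\<close>

definition tucker ::
  "real^'r1^'n1 \<Rightarrow> real^'r2^'n2 \<Rightarrow> real^'r3^'n3 \<Rightarrow> real^'r3^'r2^'r1 \<Rightarrow> real^'n3^'n2^'n1" where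
  "tucker U1 U2 U3 G = (\<chi> j1 j2 j3. \<Sum>i1\<in>UNIV. \<Sum>i2\<in>UNIV. \<Sum>i3\<in>UNIV.
     U1 $ j1 $ i1 * U2 $ j2 $ i2 * U3 $ j3 $ i3 * G $ i1 $ i2 $ i3)"

definition slice3 :: "real^'n3^'n2^'n1 \<Rightarrow> 'n3 \<Rightarrow> real^'n2^'n1" where
  "slice3 T k = (\<chi> i j. T $ i $ j $ k)"

definition slice_comb :: "real^'n3^'n2^'n1 \<Rightarrow> real^'n3 \<Rightarrow> real^'n2^'n1" where
  "slice_comb T a = (\<Sum>k\<in>UNIV. a $ k *\<^sub>R slice3 T k)"

text \<open>
  The rows of an unfolding, and the entries of a vectorized matrix, are indexed by the pairs
  \<open>(i, j)\<close> themselves instead of by their columnwise numbers \<open>i + (j - 1) * n1\<close>.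
\<close>

definition unfold3 :: "real^'n3^'n2^'n1 \<Rightarrow> real^'n3^('n1 \<times> 'n2)" where
  "unfold3 T = (\<chi> p k. T $ fst p $ snd p $ k)"

definition vectorize :: "real^'n^'m \<Rightarrow> real^('m \<times> 'n)" where
  "vectorize B = (\<chi> p. B $ fst p $ snd p)"

definition permutation_matrix :: "real^'n^'n \<Rightarrow> bool" where
  "permutation_matrix P \<longleftrightarrow> (\<exists>p. p permutes UNIV \<and> P = (\<chi> i j. if i = p j then 1 else 0))"

section \<open>The procedure\<close>

definition col_stochastic :: "real^'r^'n \<Rightarrow> bool" where
  "col_stochastic U \<longleftrightarrow> transpose U *v 1 = 1 \<and> 0 \<le> U"

definition step2_opt ::
  "real^'n2^'n1 \<Rightarrow> real^'r^'n1 \<Rightarrow> real^'r^'n2 \<Rightarrow> real^'r^'r \<Rightarrow> bool" where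
  "step2_opt B U1 U2 S \<longleftrightarrow>
     is_arg_min (\<lambda>(U1, U2, S). \<bar>det S\<bar>)
       (\<lambda>(U1, U2, S). B = U1 ** S ** transpose U2 \<and> col_stochastic U1 \<and> col_stochastic U2)
       (U1, U2, S)"

definition step3_opt :: "real^'n3^'m \<Rightarrow> real^'r3^'m \<Rightarrow> real^'r3^'n3 \<Rightarrow> bool" where
  "step3_opt B G U \<longleftrightarrow>
     is_arg_min (\<lambda>(G, U). det (transpose G ** G))
       (\<lambda>(G, U). B = G ** transpose U \<and> col_stochastic U)
       (G, U)"

text \<open>
  \<open>procedure_output T \<alpha> i1 U1 U2 U3 G\<close>: the factors \<open>U1, U2, U3\<close> and the core \<open>G\<close> can be returned
  for the drawn vectors \<open>\<alpha> i\<close>, where \<open>i1\<close> is the index of the draw used for the first two factors.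
\<close>

definition procedure_output ::
  "real^'n3^'n2^'n1 \<Rightarrow> ('n3 \<Rightarrow> real^'n3) \<Rightarrow> 'n3 \<Rightarrow>
   real^'r^'n1 \<Rightarrow> real^'r^'n2 \<Rightarrow> real^'r3^'n3 \<Rightarrow> real^'r3^'r^'r \<Rightarrow> bool" where
  "procedure_output T \<alpha> i1 U1 U2 U3 G \<longleftrightarrow>
     (let A = (\<chi> j i. \<alpha> i $ j);
          S = (\<chi> p i. vectorize (pinv U1 ** slice_comb T (\<alpha> i) ** pinv (transpose U2)) $ p)
      in (\<exists>S1. step2_opt (slice_comb T (\<alpha> i1)) U1 U2 S1) \<and>
         step3_opt (S ** matrix_inv A) (unfold3 G) U3)"

end

theory Submission
  imports Defs
begin

text \<open>
  Let \<open>R\<close> be the combination of the slices of the core with weights \<open>U3\<^sup>T \<alpha>\<close>, so that the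
  matrix factored in step 2 is \<open>U1 R U2\<^sup>T\<close>.  When \<open>R\<close> is invertible, every feasible pair has the
  form \<open>V1 = U1 Q1\<close>, \<open>V2 = U2 Q2\<close> with \<open>R = Q1 S Q2\<^sup>T\<close>, and the columns of the \<open>Qi\<close> sum to one.
  SSC1 puts these columns into the dual cone of the second-order cone, hence into the unit ball,
  and Hadamard's inequality gives \<open>\<bar>det Qi\<bar> \<le> 1\<close>.  Optimality forces equality, so the columns
  are unit vectors on the boundary of the dual cone, which by SSC2 are standard basis vectors.
  The same argument applies to \<open>U3\<close> in step 3.

  The exceptional draws are those where \<open>R\<close> or \<open>A\<close> is singular.  Both are excluded by one
  fact: a Borel set that meets all lines of a fixed direction in countable sets is Lebesgue null.
\<close>

section \<open>Hadamard's inequality\<close>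

lemma continuous_on_det:
  fixes F :: "'a::topological_space \<Rightarrow> real^'n^'n"
  assumes "\<And>i j. continuous_on S (\<lambda>x. F x $ i $ j)"
  shows "continuous_on S (\<lambda>x. det (F x))"
  unfolding det_def by (intro continuous_intros assms)

lemma borel_measurable_det:
  fixes F :: "'a \<Rightarrow> real^'n^'n"
  assumes "\<And>i j. (\<lambda>x. F x $ i $ j) \<in> borel_measurable M"
  shows "(\<lambda>x. det (F x)) \<in> borel_measurable M"
  unfolding det_def by (intro borel_measurable_sum borel_measurable_times borel_measurable_prod assms) simp

text \<open>
  At a maximizer of \<open>\<bar>det\<bar>\<close> over matrices with rows in the unit ball, no row operation may shorten
  a row, so the rows are orthonormal.
\<close>

lemma hadamard_det_le_1:
  fixes A :: "real^'n^'n"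
  assumes "\<And>i. norm (A $ i) \<le> 1"
  shows "\<bar>det A\<bar> \<le> 1"
proof -
  let ?K = "{A :: real^'n^'n. \<forall>i. norm (A $ i) \<le> 1}"
  have "norm B \<le> real CARD('n)" if "B \<in> ?K" for B
  proof -
    have "norm B \<le> (\<Sum>i\<in>UNIV. norm (B $ i))" unfolding norm_vec_def by (rule L2_set_le_sum) simp
    also have "\<dots> \<le> (\<Sum>i\<in>(UNIV::'n set). 1)" using that by (intro sum_mono) simp
    finally show ?thesis by simp
  qed
  then have "bounded ?K" unfolding bounded_iff by blast
  moreover have "closed ?K"
    by (intro closed_Collect_all closed_Collect_le continuous_intros)
  ultimately have "compact ?K" by (simp add: compact_eq_bounded_closed)
  moreover have mat1: "mat 1 \<in> ?K"
    by (auto simp: mat_def norm_vec_def L2_set_def if_distrib[of "\<lambda>x. x\<^sup>2"] cong: if_cong)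
  moreover have "continuous_on ?K (\<lambda>A. \<bar>det A\<bar>)"
    by (intro continuous_intros continuous_on_det)
  ultimately obtain B where B: "B \<in> ?K" and max: "\<And>C. C \<in> ?K \<Longrightarrow> \<bar>det C\<bar> \<le> \<bar>det B\<bar>"
    using continuous_attains_sup[of ?K "\<lambda>A. \<bar>det A\<bar>"] by auto
  have pos: "\<bar>det B\<bar> \<ge> 1" using max[OF mat1] by simp
  have ge1: "norm v \<ge> 1" if v: "\<bar>det (\<chi> k. if k = i then v else B $ k)\<bar> = \<bar>det B\<bar>" for v i
  proof (rule ccontr)
    assume "\<not> norm v \<ge> 1"
    moreover have "v \<noteq> 0" using v pos det_row_0[of i "\<lambda>k. B $ k"] by auto
    ultimately have n: "0 < norm v" "norm v < 1" by auto
    \<comment> \<open>Rescaling \<open>v\<close> to unit length keeps all rows in the unit ball and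
      multiplies \<open>\<bar>det\<bar>\<close> by \<open>1 / norm v > 1\<close>, against
      maximality.\<close>
    let ?C = "\<chi> k. if k = i then (1 / norm v) *s v else B $ k"
    have "\<bar>det ?C\<bar> = \<bar>det B\<bar> / norm v"
      using v by (simp add: det_row_mul abs_mult)
    moreover have "\<bar>det ?C\<bar> \<le> \<bar>det B\<bar>"
      using B n by (intro max) (auto simp: scalar_mult_eq_scaleR)
    ultimately have "\<bar>det B\<bar> \<le> norm v * \<bar>det B\<bar>" using n by (simp add: field_simps)
    moreover have "norm v * \<bar>det B\<bar> < 1 * \<bar>det B\<bar>" using n pos by (intro mult_strict_right_mono) auto
    ultimately show False by simp
  qed
  have unit: "norm (B $ i) = 1" for i
  proof -
    have "(\<chi> k. if k = i then B $ i else B $ k) = B" by (auto simp: vec_eq_iff)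
    then have "norm (B $ i) \<ge> 1" by (intro ge1[of i]) simp
    then show ?thesis using B by (simp add: order_antisym)
  qed
  have orth: "B $ i \<bullet> B $ j = 0" if ij: "i \<noteq> j" for i j
  proof -
    let ?s = "B $ i \<bullet> B $ j"
    \<comment> \<open>Row \<open>i\<close> minus its projection onto the unit row \<open>j\<close>:
      the determinant is unchanged and the squared length drops to \<open>1 - ?s^2\<close>, so
      \<open>?s\<close> must vanish.\<close>
    let ?v = "B $ i + (- ?s) *s B $ j"
    have "norm ?v \<ge> 1"
      using det_row_operation[OF ij, of B "- ?s"]
      by (intro ge1[of i]) (simp only: row_def vec_lambda_eta)
    then have "1 \<le> (norm ?v)\<^sup>2" by (simp add: one_le_power)
    also have "\<dots> = (norm (B $ i))\<^sup>2 - 2 * ?s\<^sup>2 + ?s\<^sup>2 * (norm (B $ j))\<^sup>2"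
      unfolding power2_norm_eq_inner
      by (simp add: scalar_mult_eq_scaleR inner_diff_left inner_diff_right inner_commute power2_eq_square)
    also have "\<dots> = 1 - ?s\<^sup>2" by (simp add: unit)
    finally show ?thesis by simp
  qed
  have "(B ** transpose B) $ i $ j = (mat 1 :: real^'n^'n) $ i $ j" for i j
  proof -
    have "(B ** transpose B) $ i $ j = B $ i \<bullet> B $ j"
      by (simp add: matrix_matrix_mult_def transpose_def inner_vec_def)
    also have "\<dots> = (if i = j then 1 else 0)"
      using orth unit by (simp add: norm_eq_1)
    finally show ?thesis by (simp add: mat_def)
  qed
  then have "B ** transpose B = mat 1" by (simp add: vec_eq_iff)
  then have "orthogonal_matrix B"
    by (simp add: orthogonal_matrix_def matrix_left_right_inverse)
  then have "\<bar>det B\<bar> = 1" using det_orthogonal_matrix[of B] by auto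
  with max[of A] assms show ?thesis by simp
qed

lemma hadamard:
  fixes A :: "real^'n^'n"
  shows "\<bar>det A\<bar> \<le> (\<Prod>i\<in>UNIV. norm (A $ i))"
proof -
  \<comment> \<open>A zero row is covered too: \<open>1 / 0 = 0\<close> makes the normalized row
    zero.\<close>
  let ?B = "\<chi> i. (1 / norm (A $ i)) *s A $ i"
  have "A = (\<chi> i. norm (A $ i) *s ?B $ i)"
    by (simp add: vec_eq_iff)
  then have "\<bar>det A\<bar> = \<bar>(\<Prod>i\<in>UNIV. norm (A $ i)) * det (\<chi> i. ?B $ i)\<bar>"
    by (metis det_rows_mul)
  also have "\<dots> = (\<Prod>i\<in>UNIV. norm (A $ i)) * \<bar>det ?B\<bar>"
    by (simp add: abs_mult prod_nonneg)
  also have "\<dots> \<le> (\<Prod>i\<in>UNIV. norm (A $ i)) * 1"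
    by (intro mult_left_mono hadamard_det_le_1 prod_nonneg) (simp_all add: scalar_mult_eq_scaleR)
  finally show ?thesis by simp
qed

text \<open>With all row lengths at most 1, their product is at most any single one of them, and
  Hadamard bounds the product below by 1.\<close>

lemma hadamard_unit_rows:
  fixes A :: "real^'n^'n"
  assumes le: "\<And>i. norm (A $ i) \<le> 1" and det: "1 \<le> \<bar>det A\<bar>"
  shows "norm (A $ i) = 1"
proof -
  have "1 \<le> (\<Prod>i\<in>UNIV. norm (A $ i))" using hadamard[of A] det by simp
  also have "\<dots> = norm (A $ i) * (\<Prod>i\<in>UNIV - {i}. norm (A $ i))"
    by (simp add: prod.remove)
  also have "\<dots> \<le> norm (A $ i) * 1"
    using le by (intro mult_left_mono prod_le_1) auto
  finally show ?thesis using le[of i] by simp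
qed

section \<open>Consequences of the sufficiently scattered condition\<close>

lemma one_inner_eq_sum: "1 \<bullet> (x :: real^'n) = (\<Sum>i\<in>UNIV. x $ i)"
  by (simp add: inner_vec_def)

lemma norm_one_vec: "(norm (1 :: real^'n))\<^sup>2 = real CARD('n)"
  by (simp add: power2_norm_eq_inner inner_vec_def)

text \<open>Dual form of SSC1: enlarging a cone shrinks its dual, and the dual of the cone in SSC1
  is the second-order cone \<open>norm y \<le> 1 \<bullet> y\<close>.\<close>

lemma SSC_dual_cone_norm_le:
  fixes H :: "real^'r^'n"
  assumes "SSC H" and y: "0 \<le> H *v y"
  shows "norm y \<le> 1 \<bullet> y"
proof -
  define r where "r = real CARD('r)"
  have r2: "r \<ge> 2" using assms(1) by (simp add: SSC_def r_def)
  have dual: "0 \<le> x \<bullet> y" if x: "1 \<bullet> x \<ge> sqrt (r - 1) * norm x" for x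
  proof -
    \<comment> \<open>If a coordinate were negative, dropping it and applying Cauchy-Schwarz to the
      remaining \<open>r - 1\<close> coordinates would give
      \<open>1 \<bullet> x < sqrt (r - 1) * norm x\<close>.\<close>
    have "x $ i \<ge> 0" for i
    proof (rule ccontr)
      assume neg: "\<not> x $ i \<ge> 0"
      have "1 \<bullet> x = x $ i + (\<Sum>j\<in>UNIV - {i}. x $ j)"
        by (simp add: one_inner_eq_sum sum.remove)
      also have "\<dots> < (\<Sum>j\<in>UNIV - {i}. x $ j)" using neg by simp
      also have "\<dots> \<le> (\<Sum>j\<in>UNIV - {i}. \<bar>1\<bar> * \<bar>x $ j\<bar>)"
        by (intro sum_mono) simp
      also have "\<dots> \<le> L2_set (\<lambda>_. 1) (UNIV - {i}) * L2_set (\<lambda>j. x $ j) (UNIV - {i})"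
        by (rule L2_set_mult_ineq)
      also have "\<dots> \<le> sqrt (r - 1) * norm x"
      proof (intro mult_mono)
        show "L2_set (\<lambda>_. 1) (UNIV - {i}) \<le> sqrt (r - 1)"
          using r2 by (simp add: L2_set_def card_Diff_singleton r_def of_nat_diff)
        show "L2_set (\<lambda>j. x $ j) (UNIV - {i}) \<le> norm x"
          by (auto simp: L2_set_def norm_vec_def intro!: sum_mono2)
      qed (use r2 in \<open>simp_all add: L2_set_nonneg\<close>)
      finally show False using x by simp
    qed
    then have "0 \<le> x" by (simp add: less_eq_vec_def)
    then obtain z where z: "x = transpose H *v z" "0 \<le> z"
      using assms(1) x unfolding SSC_def mat_cone_def r_def by blast
    have "x \<bullet> y = z \<bullet> (H *v y)"
      by (metis z(1) dot_lmul_matrix transpose_matrix_vector)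
    also have "\<dots> \<ge> 0"
      using z(2) y by (auto simp: inner_vec_def less_eq_vec_def intro!: sum_nonneg)
    finally show ?thesis .
  qed
  \<comment> \<open>Split \<open>y\<close> into a multiple of the all-ones vector and an orthogonal
    part \<open>u\<close>. By Pythagoras the claim becomes
    \<open>c * norm u \<le> s\<close>.\<close>
  define s where "s = 1 \<bullet> y"
  define u where "u = y - (s / r) *\<^sub>R 1"
  define c where "c = sqrt (r / (r - 1))"
  have n1: "(1 :: real^'r) \<bullet> 1 = r" using norm_one_vec[where 'n='r] by (simp add: power2_norm_eq_inner r_def)
  have u1: "1 \<bullet> u = 0" using r2 by (simp add: u_def inner_diff_right n1 s_def)
  have yu: "y = u + (s / r) *\<^sub>R 1" by (simp add: u_def)
  have uy: "u \<bullet> y = (norm u)\<^sup>2"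
    by (simp add: yu inner_add_right inner_commute[of u 1] u1 power2_norm_eq_inner)
  have ny: "(norm y)\<^sup>2 = (norm u)\<^sup>2 + s\<^sup>2 / r"
    unfolding yu power2_norm_eq_inner
    using r2 by (simp add: inner_add_left inner_add_right n1 u1 inner_commute[of u 1] power2_eq_square)
  have c2: "c\<^sup>2 = r / (r - 1)" using r2 by (simp add: c_def)
  have c0: "c \<ge> 0" using r2 by (simp add: c_def)
  \<comment> \<open>the extreme ray of the second-order cone that points away from \<open>y\<close>; here \<open>c / 0 = 0\<close> covers \<open>u = 0\<close>\<close>
  define x where "x = 1 - (c / norm u) *\<^sub>R u"
  have "(norm x)\<^sup>2 = r + (c / norm u)\<^sup>2 * (norm u)\<^sup>2"
    unfolding x_def power2_norm_eq_inner
    by (simp add: inner_diff_left inner_diff_right n1 u1 inner_commute[of u 1] power2_eq_square)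
  also have "\<dots> \<le> r + c\<^sup>2" by (cases "u = 0") (simp_all add: power_divide)
  also have "\<dots> = r\<^sup>2 / (r - 1)" unfolding c2 using r2 by (simp add: field_simps power2_eq_square)
  finally have "(r - 1) * (norm x)\<^sup>2 \<le> r\<^sup>2" using r2 by (simp add: field_simps)
  then have "(sqrt (r - 1) * norm x)\<^sup>2 \<le> r\<^sup>2" using r2 by (simp add: power_mult_distrib)
  then have "sqrt (r - 1) * norm x \<le> r" by (rule power2_le_imp_le) (use r2 in simp)
  moreover have "1 \<bullet> x = r" by (simp add: x_def inner_diff_right n1 u1)
  ultimately have "0 \<le> x \<bullet> y" by (intro dual) simp
  also have "x \<bullet> y = s - (c / norm u) * (norm u)\<^sup>2"
    by (simp add: x_def inner_diff_left uy s_def)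
  also have "\<dots> = s - c * norm u" by (simp add: power2_eq_square)
  finally have le: "c * norm u \<le> s" by simp
  then have s0: "s \<ge> 0" using c0 by (meson mult_nonneg_nonneg norm_ge_zero order_trans)
  have "(c * norm u)\<^sup>2 \<le> s\<^sup>2" using le c0 by (intro power_mono) simp_all
  then have "r / (r - 1) * (norm u)\<^sup>2 \<le> s\<^sup>2" by (simp add: power_mult_distrib c2)
  then have "(norm u)\<^sup>2 \<le> s\<^sup>2 - s\<^sup>2 / r" using r2 by (simp add: field_simps)
  then have "(norm y)\<^sup>2 \<le> s\<^sup>2" by (simp add: ny)
  then have "norm y \<le> s" using s0 by (rule power2_le_imp_le)
  then show ?thesis by (simp only: s_def)
qed

text \<open>A kernel vector and its negative both lie in the dual cone, and the second-order cone
  contains no line.\<close>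

lemma SSC_left_invertible:
  fixes H :: "real^'r^'n"
  assumes "SSC H"
  obtains L where "L ** H = mat 1"
proof -
  have "y = 0" if "H *v y = 0" for y
  proof -
    have "norm y \<le> 1 \<bullet> y" by (rule SSC_dual_cone_norm_le[OF assms]) (simp add: that)
    moreover have "H *v (- y) = 0"
      by (metis minus_zero that vec.neg)
    then have "norm (- y) \<le> 1 \<bullet> (- y)" by (intro SSC_dual_cone_norm_le[OF assms]) simp
    then have "norm y \<le> - (1 \<bullet> y)" by simp
    ultimately have "norm y \<le> 0" by linarith
    then show ?thesis by simp
  qed
  then have "\<exists>L. L ** H = mat 1" by (simp add: matrix_left_invertible_ker)
  then show ?thesis using that by blast
qed

text \<open>In dimension 1 the cone is a half-line with every positive \<open>q\<close> in its
  interior, hence the dimension bound.\<close>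

lemma norm_eq_sum_in_frontier:
  fixes q :: "real^'r"
  assumes r: "2 \<le> CARD('r)" and q: "1 \<bullet> q = norm q" and nz: "q \<noteq> 0"
  shows "q \<in> frontier {x. 1 \<bullet> x \<ge> norm x}"
proof -
  have "q \<notin> interior {x. 1 \<bullet> x \<ge> norm x}"
  proof
    assume "q \<in> interior {x. 1 \<bullet> x \<ge> norm x}"
    then obtain e where e: "e > 0" "\<And>x. dist x q < e \<Longrightarrow> 1 \<bullet> x \<ge> norm x"
      unfolding mem_interior ball_def by (auto simp: dist_commute subset_iff)
    define d where "d = e / (2 * norm (1 :: real^'r))"
    have n1: "norm (1 :: real^'r) > 0" by simp
    have d: "d > 0" using e(1) n1 unfolding d_def by (intro divide_pos_pos) simp_all
    \<comment> \<open>Step back along the all-ones direction by a distance \<open>e / 2\<close>.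
      Cauchy-Schwarz against \<open>q\<close> then turns membership of \<open>?x\<close> into
      \<open>d * CARD('r) \<le> d\<close>.\<close>
    let ?x = "q - d *\<^sub>R 1"
    have "dist ?x q = e / 2"
      using e(1) n1 by (simp add: dist_norm d_def abs_of_pos)
    then have "norm ?x \<le> 1 \<bullet> ?x" using e by simp
    then have "norm q * norm ?x \<le> norm q * (1 \<bullet> ?x)" by (rule mult_left_mono) simp
    moreover have "q \<bullet> ?x \<le> norm q * norm ?x" by (rule norm_cauchy_schwarz)
    ultimately have "q \<bullet> ?x \<le> norm q * (1 \<bullet> ?x)" by simp
    moreover have "q \<bullet> ?x = norm q * (norm q - d)"
      by (simp add: inner_diff_right power2_norm_eq_inner[symmetric] inner_commute[of q 1] q power2_eq_square algebra_simps)
    moreover have "1 \<bullet> ?x = norm q - d * real CARD('r)"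
      using norm_one_vec[where 'n='r] by (simp add: inner_diff_right q power2_norm_eq_inner)
    ultimately have "norm q - d \<le> norm q - d * real CARD('r)" using nz by simp
    then have "d * real CARD('r) \<le> d * 1" by simp
    then show False using d r by simp
  qed
  then show ?thesis using q closure_subset[of "{x. 1 \<bullet> x \<ge> norm x}"] by (auto simp: frontier_def)
qed

text \<open>Applied to the change of basis \<open>Q\<close> between two feasible factors
  \<open>U\<close> and \<open>U ** Q\<close>. SSC1 yields the bound, SSC2 its equality case.\<close>

lemma SSC_factor_permutation:
  fixes H :: "real^'r^'n" and Q :: "real^'r^'r"
  assumes H: "SSC H" and Q: "0 \<le> H ** Q" "transpose Q *v 1 = 1"
  shows "\<bar>det Q\<bar> \<le> 1" and "1 \<le> \<bar>det Q\<bar> \<Longrightarrow> permutation_matrix Q"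
proof -
  let ?q = "\<lambda>j. transpose Q $ j"
  have one: "1 \<bullet> ?q j = 1" for j
    using Q(2) by (simp add: vec_eq_iff matrix_vector_mult_def inner_vec_def)
  have dual: "0 \<le> H *v ?q j" for j
    using Q(1) by (simp add: less_eq_vec_def matrix_vector_mult_def matrix_matrix_mult_def transpose_def)
  have le: "norm (?q j) \<le> 1" for j
    using SSC_dual_cone_norm_le[OF H dual] one by metis
  show "\<bar>det Q\<bar> \<le> 1" using hadamard_det_le_1[of "transpose Q"] le by (simp add: det_transpose)
  assume det: "1 \<le> \<bar>det Q\<bar>"
  have "\<exists>k. ?q j = axis k 1" for j
  proof -
    have n: "norm (?q j) = 1" using hadamard_unit_rows[of "transpose Q"] le det by (simp add: det_transpose)
    then have "?q j \<noteq> 0" by auto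
    then have "?q j \<in> frontier {x. 1 \<bullet> x \<ge> norm x}"
      using H n one by (intro norm_eq_sum_in_frontier) (auto simp: SSC_def)
    moreover have "?q j \<in> mat_dual_cone (transpose H)" using dual by (simp add: mat_dual_cone_def)
    ultimately obtain l k where lk: "?q j = l *\<^sub>R axis k 1" using H unfolding SSC_def by blast
    \<comment> \<open>The column sum fixes the scale along the ray.\<close>
    then have "l = 1" using one[of j] by (simp add: inner_axis)
    then show ?thesis using lk by auto
  qed
  then obtain p where p: "\<And>j. ?q j = axis (p j) 1" by metis
  have ent: "Q $ i $ j = (if i = p j then 1 else 0)" for i j
  proof -
    have "Q $ i $ j = ?q j $ i" by (simp add: transpose_def)
    then show ?thesis by (simp add: p axis_def)
  qed
  \<comment> \<open>Two columns equal to the same basis vector would make the determinant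
    zero.\<close>
  have "inj p"
  proof (rule injI, rule ccontr)
    fix i j assume "p i = p j" "i \<noteq> j"
    then have "det Q = 0"
      by (intro det_identical_columns[of i j]) (auto simp: column_def ent)
    then show False using det by simp
  qed
  then have "p permutes UNIV" by (intro bij_imp_permutes) (simp_all add: bij_betw_def finite_UNIV_inj_surj)
  then show "permutation_matrix Q" unfolding permutation_matrix_def
    by (intro exI[of _ p]) (simp add: vec_eq_iff ent)
qed

section \<open>Matrix and tensor algebra\<close>

text \<open>Cancelling \<open>X\<close> writes \<open>U\<close> as \<open>V\<close> times a square
  matrix. The left inverse of \<open>U\<close> makes that matrix invertible, with inverse
  \<open>L ** V\<close>, so the relation can be reversed.\<close>

lemma matrix_factor_through:
  fixes U V :: "real^'r^'n" and W X :: "real^'m^'r"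
  assumes eq: "U ** X = V ** W" and L: "L ** U = mat 1" and Y: "X ** Y = mat 1"
  obtains Q where "V = U ** Q" "invertible Q"
proof -
  have UV: "U = V ** (W ** Y)"
    using arg_cong[OF eq, of "\<lambda>Z. Z ** Y"] by (simp add: Y flip: matrix_mul_assoc)
  then have 1: "(L ** V) ** (W ** Y) = mat 1" using L by (simp add: matrix_mul_assoc)
  then have 2: "(W ** Y) ** (L ** V) = mat 1" by (simp add: matrix_left_right_inverse)
  have "U ** (L ** V) = V ** ((W ** Y) ** (L ** V))"
    by (subst UV) (simp add: matrix_mul_assoc)
  then have "V = U ** (L ** V)" by (simp add: 2)
  moreover have "invertible (L ** V)" using 1 2 by (auto simp: invertible_def)
  ultimately show ?thesis by (rule that)
qed

lemma col_stochastic_factor: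
  assumes "transpose U *v 1 = 1" "col_stochastic (U ** Q)"
  shows "transpose Q *v 1 = 1"
  using assms by (metis col_stochastic_def matrix_transpose_mul matrix_vector_mul_assoc)

lemma permutation_matrix_orthogonal:
  assumes "permutation_matrix P"
  shows "P ** transpose P = mat 1" "transpose P ** P = mat 1"
proof -
  obtain p where p: "p permutes UNIV" "P = (\<chi> i j. if i = p j then 1 else 0)"
    using assms unfolding permutation_matrix_def by blast
  have "inj p" using p(1) by (rule permutes_inj)
  then have "transpose P ** P = mat 1"
    by (auto simp: vec_eq_iff p(2) matrix_matrix_mult_def transpose_def mat_def inj_eq
          if_distrib[of "\<lambda>x. x * _"] cong: if_cong)
  then show "transpose P ** P = mat 1" "P ** transpose P = mat 1"
    by (simp_all add: matrix_left_right_inverse)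
qed

lemma permutation_matrix_transpose:
  assumes "permutation_matrix P"
  shows "permutation_matrix (transpose P)"
proof -
  obtain p where p: "p permutes UNIV" "P = (\<chi> i j. if i = p j then 1 else 0)"
    using assms unfolding permutation_matrix_def by blast
  have "transpose P = (\<chi> i j. if i = inv p j then 1 else 0)"
    using permutes_inverses[OF p(1)] by (auto simp: p(2) transpose_def vec_eq_iff)
  then show ?thesis using permutes_inv[OF p(1)] unfolding permutation_matrix_def by blast
qed

text \<open>A left inverse cancels the outer \<open>V\<close> in
  \<open>V ** pinv V ** V = V\<close>. This removes the computed factors from the matrix
  \<open>S\<close> of step 3.\<close>

lemma pinv_of_left_invertible:
  fixes V :: "real^'r^'n"
  assumes "L ** V = mat 1"
  shows "pinv V ** V = mat 1" and "transpose V ** pinv (transpose V) = mat 1"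
proof -
  have "V ** pinv V ** V = V" using is_pinv_pinv[of V] by (simp add: is_pinv_def)
  then have "L ** V ** pinv V ** V = L ** V" by (simp flip: matrix_mul_assoc)
  then show "pinv V ** V = mat 1" by (simp add: assms)
  have L': "transpose V ** transpose L = mat 1" using assms by (metis matrix_transpose_mul transpose_mat)
  have "transpose V ** pinv (transpose V) ** transpose V = transpose V"
    using is_pinv_pinv[of "transpose V"] by (simp add: is_pinv_def)
  then have "transpose V ** pinv (transpose V) ** (transpose V ** transpose L) = transpose V ** transpose L"
    by (simp add: matrix_mul_assoc)
  then show "transpose V ** pinv (transpose V) = mat 1" by (simp add: L')
qed

text \<open>The Gram matrix is joined to the identity by a segment of invertible matrices.\<close>

lemma gram_det_pos:
  fixes A :: "real^'n^'m"
  assumes "L ** A = mat 1"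
  shows "det (transpose A ** A) > 0"
proof -
  define F :: "real \<Rightarrow> real^'n^'n" where "F t = (1 - t) *\<^sub>R (transpose A ** A) + t *\<^sub>R mat 1" for t
  have nz: "det (F t) \<noteq> 0" if t: "0 \<le> t" "t \<le> 1" for t
  proof -
    have "x = 0" if x: "F t *v x = 0" for x
    proof -
      \<comment> \<open>The quadratic form of \<open>F t\<close> is a sum of two nonnegative terms.
        Their vanishing gives \<open>A *v x = 0\<close> or \<open>x = 0\<close>, and
        \<open>A\<close> is injective.\<close>
      have "0 = (F t *v x) \<bullet> x" by (simp add: x)
      also have "F t *v x = (1 - t) *\<^sub>R (transpose A *v (A *v x)) + t *\<^sub>R x"
        by (simp add: F_def matrix_vector_mult_add_rdistrib scaleR_matrix_vector_assoc[symmetric] matrix_vector_mul_assoc)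
      also have "\<dots> \<bullet> x = (1 - t) * ((transpose A *v (A *v x)) \<bullet> x) + t * (x \<bullet> x)"
        by (simp add: inner_add_left)
      also have "(transpose A *v (A *v x)) \<bullet> x = (A *v x) \<bullet> (A *v x)"
        by (metis dot_lmul_matrix transpose_matrix_vector)
      finally have s: "(1 - t) * ((A *v x) \<bullet> (A *v x)) + t * (x \<bullet> x) = 0" by simp
      have "(1 - t) * ((A *v x) \<bullet> (A *v x)) \<ge> 0" "t * (x \<bullet> x) \<ge> 0" using t by simp_all
      with s have "(1 - t) * ((A *v x) \<bullet> (A *v x)) = 0" "t * (x \<bullet> x) = 0" by linarith+
      then have "A *v x = 0 \<or> x = 0" by auto
      moreover have "x = 0" if "A *v x = 0"
        using that assms by (metis matrix_left_invertible_ker)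
      ultimately show ?thesis by blast
    qed
    then have "\<exists>B. B ** F t = mat 1" by (simp add: matrix_left_invertible_ker)
    then show ?thesis by (simp flip: invertible_left_inverse invertible_det_nz)
  qed
  show ?thesis
  proof (rule ccontr)
    assume "\<not> ?thesis"
    then have "det (F 0) \<le> 0" by (simp add: F_def)
    moreover have "0 \<le> det (F 1)" by (simp add: F_def)
    moreover have "continuous_on {0..1} (\<lambda>t. det (F t))"
      unfolding F_def det_def by (intro continuous_intros)
    ultimately obtain t where "0 \<le> t" "t \<le> 1" "det (F t) = 0"
      using IVT'[of "\<lambda>t. det (F t)" 0 0 1] by auto
    then show False using nz by blast
  qed
qed

section \<open>Tensors seen through combinations of their slices\<close>

lemma slice_comb_nth: "slice_comb T a $ i $ j = (\<Sum>k\<in>UNIV. a $ k * T $ i $ j $ k)"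
  by (simp add: slice_comb_def slice3_def)

lemma slice_comb_axis: "slice_comb T (axis k 1) $ i $ j = T $ i $ j $ k"
  by (simp add: slice_comb_nth axis_def if_distrib[of "\<lambda>x. x * _"] cong: if_cong)

text \<open>Basis vectors as weights return the single slices. Tensor identities thus reduce to
  matrix identities.\<close>

lemma slice_comb_eqI:
  assumes "\<And>a. slice_comb T a = slice_comb T' a"
  shows "T = T'"
  unfolding vec_eq_iff by (metis assms slice_comb_axis)

lemma slice_comb_add: "slice_comb T (a + b) = slice_comb T a + slice_comb T b"
  by (simp add: slice_comb_def scaleR_add_left sum.distrib)

lemma slice_comb_scaleR: "slice_comb T (c *\<^sub>R a) = c *\<^sub>R slice_comb T a"
  by (simp add: slice_comb_def scaleR_sum_right)

text \<open>Contracting the third mode turns the decomposition into the matrix factorization of step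
  2, with weights moved from \<open>a\<close> to \<open>transpose C *v a\<close>.\<close>

lemma slice_comb_tucker:
  "slice_comb (tucker A B C G) a = A ** slice_comb G (transpose C *v a) ** transpose B"
proof -
  have "slice_comb (tucker A B C G) a $ i $ j
      = (A ** slice_comb G (transpose C *v a) ** transpose B) $ i $ j" for i j
  proof -
    let ?t = "\<lambda>k p q s. A $ i $ p * G $ p $ q $ s * B $ j $ q * (C $ k $ s * a $ k)"
    have "slice_comb (tucker A B C G) a $ i $ j
      = (\<Sum>k\<in>UNIV. \<Sum>p\<in>UNIV. \<Sum>q\<in>UNIV. \<Sum>s\<in>UNIV. ?t k p q s)"
      by (simp add: slice_comb_nth tucker_def sum_distrib_left mult_ac)
    also have "\<dots> = (\<Sum>p\<in>UNIV. \<Sum>k\<in>UNIV. \<Sum>q\<in>UNIV. \<Sum>s\<in>UNIV. ?t k p q s)"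
      by (rule sum.swap)
    also have "\<dots> = (\<Sum>p\<in>UNIV. \<Sum>q\<in>UNIV. \<Sum>k\<in>UNIV. \<Sum>s\<in>UNIV. ?t k p q s)"
      by (intro sum.cong refl sum.swap)
    also have "\<dots> = (\<Sum>p\<in>UNIV. \<Sum>q\<in>UNIV. \<Sum>s\<in>UNIV. \<Sum>k\<in>UNIV. ?t k p q s)"
      by (intro sum.cong refl sum.swap)
    also have "\<dots> = (\<Sum>q\<in>UNIV. \<Sum>p\<in>UNIV. \<Sum>s\<in>UNIV. \<Sum>k\<in>UNIV. ?t k p q s)"
      by (rule sum.swap)
    also have "\<dots> = (A ** slice_comb G (transpose C *v a) ** transpose B) $ i $ j"
      by (simp add: matrix_matrix_mult_def matrix_vector_mult_def transpose_def slice_comb_nth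
            sum_distrib_left sum_distrib_right mult_ac)
    finally show ?thesis .
  qed
  then show ?thesis by (simp add: vec_eq_iff)
qed

lemma tucker_tucker:
  "tucker A B C (tucker A' B' C' G) = tucker (A ** A') (B ** B') (C ** C') G"
  by (rule slice_comb_eqI)
    (simp add: slice_comb_tucker matrix_mul_assoc matrix_vector_mul_assoc matrix_transpose_mul
        del: transpose_matrix_vector)

lemma tucker_mat_1: "tucker (mat 1) (mat 1) (mat 1) G = G"
  by (rule slice_comb_eqI) (simp add: slice_comb_tucker transpose_mat)

lemma unfold3_mult: "unfold3 G *v v = vectorize (slice_comb G v)"
  by (simp add: vec_eq_iff unfold3_def vectorize_def slice_comb_nth matrix_vector_mult_def mult_ac)

lemma unfold3_inject: "unfold3 G = unfold3 G' \<longleftrightarrow> G = G'"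
  by (auto simp: unfold3_def vec_eq_iff)

lemma vectorize_eq_0: "vectorize B = 0 \<longleftrightarrow> B = 0"
  by (auto simp: vectorize_def vec_eq_iff)

text \<open>Connects the tensor to the factorization constraint of step 3.\<close>

lemma unfold3_tucker_third:
  "unfold3 (tucker (mat 1) (mat 1) C G) = unfold3 G ** transpose C"
  by (simp add: matrix_eq unfold3_mult slice_comb_tucker transpose_mat
        flip: matrix_vector_mul_assoc)

section \<open>Generic invertibility\<close>

text \<open>Translation invariance and Fubini replace a change of coordinates making
  \<open>w\<close> an axis. For \<open>w = 0\<close> the hypothesis forces \<open>Z\<close> to be
  empty.\<close>

lemma null_set_of_countable_lines:
  fixes Z :: "'a::euclidean_space set"
  assumes Z: "Z \<in> sets borel" and lines: "\<And>x. countable {t. x + t *\<^sub>R w \<in> Z}"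
  shows "Z \<in> null_sets lborel"
proof -
  have [measurable]: "Z \<in> sets borel" by (rule Z)
  \<comment> \<open>average the translates of \<open>Z\<close> by \<open>t w\<close>, \<open>t \<in> [0, 1]\<close>, and exchange the integrals\<close>
  have "emeasure lborel Z = (\<integral>\<^sup>+ t. emeasure lborel Z * indicator {0..1::real} t \<partial>lborel)"
    by (subst nn_integral_cmult) (simp_all add: emeasure_lborel_Icc_eq)
  also have "\<dots> = (\<integral>\<^sup>+ t. (\<integral>\<^sup>+ x. indicator Z (x + t *\<^sub>R w) * indicator {0..1} t \<partial>lborel) \<partial>(lborel :: real measure))"
  proof (intro nn_integral_cong)
    fix t :: real
    have "emeasure lborel Z = (\<integral>\<^sup>+ x. indicator Z x \<partial>distr lborel borel ((+) (t *\<^sub>R w)))"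
      by (simp add: lborel_distr_plus)
    also have "\<dots> = (\<integral>\<^sup>+ x. indicator Z (t *\<^sub>R w + x) \<partial>lborel)"
      by (subst nn_integral_distr) simp_all
    finally show "emeasure lborel Z * indicator {0..1} t
        = (\<integral>\<^sup>+ x. indicator Z (x + t *\<^sub>R w) * indicator {0..1} t \<partial>lborel)"
      by (subst nn_integral_multc) (simp_all add: add.commute)
  qed
  also have "\<dots> = (\<integral>\<^sup>+ x. (\<integral>\<^sup>+ t. indicator Z (x + t *\<^sub>R w) * indicator {0..1} t \<partial>lborel) \<partial>(lborel :: 'a measure))"
    by (intro lborel_pair.Fubini') measurable
  also have "\<dots> = (\<integral>\<^sup>+ x. 0 \<partial>(lborel :: 'a measure))"
  proof (intro nn_integral_cong)
    fix x :: 'a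
    have "{t. x + t *\<^sub>R w \<in> Z} \<in> null_sets lborel"
      using lines by (rule countable_imp_null_set_lborel)
    then have "AE t in lborel. indicator Z (x + t *\<^sub>R w) * indicator {0..1::real} t = (0::ennreal)"
      by (rule AE_I') (auto simp: indicator_def)
    then show "(\<integral>\<^sup>+ t. indicator Z (x + t *\<^sub>R w) * indicator {0..1} t \<partial>lborel) = 0"
      by (subst nn_integral_0_iff_AE) simp_all
  qed
  finally show ?thesis using Z by (auto simp: null_sets_def)
qed

text \<open>Criterion for both exceptional events: each is the zero set of a determinant that is a
  nonzero polynomial along lines of one direction.\<close>

lemma AE_absolutely_continuous_lborel:
  fixes D :: "('a::euclidean_space) measure"
  assumes D: "absolutely_continuous lborel D" and sets: "sets D = sets borel"
    and P: "{x. \<not> P x} \<in> sets borel" and lines: "\<And>x. finite {t. \<not> P (x + t *\<^sub>R w)}"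
  shows "AE x in D. P x"
proof (rule AE_I')
  have "{x. \<not> P x} \<in> null_sets lborel"
    using P lines by (intro null_set_of_countable_lines[where w = w]) (auto intro: countable_finite)
  then show "{x. \<not> P x} \<in> null_sets D" using D by (auto simp: absolutely_continuous_def)
qed auto

text \<open>For \<open>t \<noteq> 0\<close> the determinant is \<open>t^n * det (B + A / t)\<close>,
  so such zeros are reciprocals of roots of a nonzero polynomial; the point 0 is added by
  hand.\<close>

lemma finite_det_pencil_zeros:
  fixes A B :: "real^'n^'n"
  assumes "det B \<noteq> 0"
  shows "finite {t. det (A + t *\<^sub>R B) = 0}"
proof -
  \<comment> \<open>reversing the pencil makes \<open>det B\<close> the constant term\<close>
  define p where "p = (\<Sum>q\<in>{q. q permutes (UNIV::'n set)}.
    of_int (sign q) * (\<Prod>i\<in>UNIV. [:B $ i $ q i, A $ i $ q i:]))"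
  have p: "poly p s = det (B + s *\<^sub>R A)" for s
    by (simp add: p_def det_def poly_sum poly_prod)
  have "poly p 0 \<noteq> 0" using assms by (simp add: p)
  then have "p \<noteq> 0" by auto
  then have fin: "finite {s. poly p s = 0}" by (rule poly_roots_finite)
  have "{t. det (A + t *\<^sub>R B) = 0} \<subseteq> insert 0 (inverse ` {s. poly p s = 0})"
  proof
    fix t assume t: "t \<in> {t. det (A + t *\<^sub>R B) = 0}"
    show "t \<in> insert 0 (inverse ` {s. poly p s = 0})"
    proof (cases "t = 0")
      case False
      then have eq: "A + t *\<^sub>R B = (\<chi> i. t *s (B + inverse t *\<^sub>R A) $ i)"
        by (simp add: vec_eq_iff field_simps)
      have "det (A + t *\<^sub>R B) = (\<Prod>i\<in>(UNIV::'n set). t) * det (B + inverse t *\<^sub>R A)"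
        unfolding eq det_rows_mul by (simp only: vec_lambda_eta)
      then have "poly p (inverse t) = 0" using t False by (simp add: p)
      then show ?thesis using False by (force simp: image_iff intro: exI[of _ "inverse t"])
    qed simp
  qed
  then show ?thesis using fin by (meson finite_imageI finite_insert finite_subset)
qed

text \<open>
  The standard basis is replaced row by row.  Given the rows already drawn, the determinant is
  affine along the basis vector being replaced, with nonzero slope.
\<close>

lemma (in prob_space) AE_det_of_independent_rows:
  fixes X :: "'n::finite \<Rightarrow> 'a \<Rightarrow> real^'n"
  assumes indep: "indep_vars (\<lambda>_. borel) X UNIV"
    and D: "\<And>i. absolutely_continuous lborel (distr M borel (X i))"
  shows "AE \<omega> in M. det (\<chi> i. X i \<omega>) \<noteq> 0"
proof -
  \<comment> \<open>Rows outside \<open>J\<close> are still basis vectors, so the induction runs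
    from the identity matrix to the matrix of all draws.\<close>
  let ?A = "\<lambda>J f. \<chi> k. if k \<in> J then f k else axis k (1::real)"
  have X[measurable]: "X i \<in> borel_measurable M" for i
    using indep by (auto simp: indep_vars_def)
  have "AE \<omega> in M. det (?A J (\<lambda>k. X k \<omega>)) \<noteq> 0" if "finite J" for J
    using that
  proof induction
    case empty
    have "(\<chi> k. axis k 1) = (mat 1 :: real^'n^'n)" by (auto simp: vec_eq_iff mat_def axis_def)
    then show ?case by simp
  next
    case (insert i J)
    let ?P = "PiM J (\<lambda>_. borel :: (real^'n) measure)"
    let ?Y = "\<lambda>\<omega>. restrict (\<lambda>k. X k \<omega>) J"
    let ?B = "\<lambda>f x. \<chi> k. if k = i then x else if k \<in> J then f k else axis k (1::real)"
    \<comment> \<open>The new draw is kept as a function on the singleton \<open>{i}\<close>, the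
      form in which \<open>indep_var_restrict\<close> gives independence; hence
      \<open>snd z i\<close> below.\<close>
    let ?N = "PiM {i} (\<lambda>_. borel :: (real^'n) measure)"
    let ?Z = "\<lambda>\<omega>. restrict (\<lambda>k. X k \<omega>) {i}"
    have ind: "indep_var ?P ?Y ?N ?Z"
      using insert.hyps by (intro indep_var_restrict[OF indep]) auto
    then have Y[measurable]: "?Y \<in> measurable M ?P" and Z[measurable]: "?Z \<in> measurable M ?N"
      by (blast dest: indep_var_rv1 indep_var_rv2)+
    \<comment> \<open>The joint law is a product, so the earlier rows can be frozen while row
      \<open>i\<close> varies.\<close>
    have eq: "distr M ?P ?Y \<Otimes>\<^sub>M distr M ?N ?Z = distr M (?P \<Otimes>\<^sub>M ?N) (\<lambda>\<omega>. (?Y \<omega>, ?Z \<omega>))"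
      using ind unfolding indep_var_distribution_eq by blast
    interpret Y: prob_space "distr M ?P ?Y" by (rule prob_space_distr) simp
    interpret Z: prob_space "distr M ?N ?Z" by (rule prob_space_distr) simp
    interpret pair_sigma_finite "distr M ?P ?Y" "distr M ?N ?Z" ..
    have ent: "(\<lambda>z. ?B (fst z) (snd z i) $ k $ l) \<in> borel_measurable (?P \<Otimes>\<^sub>M ?N)" for k l
    proof (cases "k = i")
      case True
      have "(\<lambda>z. snd z i) \<in> borel_measurable (?P \<Otimes>\<^sub>M ?N)" by measurable
      then have "(\<lambda>z. snd z i $ l) \<in> borel_measurable (?P \<Otimes>\<^sub>M ?N)"
        by (rule measurable_compose[OF _ borel_measurable_nth])
      then show ?thesis using True by simp
    next
      case False
      have "(\<lambda>z. fst z k $ l) \<in> borel_measurable (?P \<Otimes>\<^sub>M ?N)" if [measurable]: "k \<in> J"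
      proof -
        have "(\<lambda>z. fst z k) \<in> borel_measurable (?P \<Otimes>\<^sub>M ?N)" by measurable
        then show ?thesis by (rule measurable_compose[OF _ borel_measurable_nth])
      qed
      then show ?thesis using False by (cases "k \<in> J") simp_all
    qed
    have meas: "(\<lambda>z. det (?B (fst z) (snd z i))) \<in> borel_measurable (?P \<Otimes>\<^sub>M ?N)"
      by (intro borel_measurable_det ent)
    have "{z \<in> space (?P \<Otimes>\<^sub>M ?N). det (?B (fst z) (snd z i)) \<noteq> 0} \<in> sets (?P \<Otimes>\<^sub>M ?N)"
      using meas by measurable
    moreover have sets: "sets (distr M ?P ?Y \<Otimes>\<^sub>M distr M ?N ?Z) = sets (?P \<Otimes>\<^sub>M ?N)"
      by (rule sets_pair_measure_cong) simp_all
    ultimately have set: "{z \<in> space (distr M ?P ?Y \<Otimes>\<^sub>M distr M ?N ?Z). det (?B (fst z) (snd z i)) \<noteq> 0}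
        \<in> sets (distr M ?P ?Y \<Otimes>\<^sub>M distr M ?N ?Z)"
      by (simp only: sets_eq_imp_space_eq[OF sets] sets)
    have "AE f in distr M ?P ?Y. det (?A J f) \<noteq> 0"
    proof (subst AE_distr_iff)
      have "(\<lambda>f. det (?A J f)) \<in> borel_measurable ?P"
      proof (rule borel_measurable_det)
        fix k l show "(\<lambda>f. ?A J f $ k $ l) \<in> borel_measurable ?P"
          by (cases "k \<in> J") (auto intro!: measurable_compose[OF measurable_component_singleton])
      qed
      then show "{f \<in> space ?P. det (?A J f) \<noteq> 0} \<in> sets ?P" by measurable
      have "?A J (?Y \<omega>) = ?A J (\<lambda>k. X k \<omega>)" for \<omega> by (auto simp: vec_eq_iff)
      then show "AE \<omega> in M. det (?A J (?Y \<omega>)) \<noteq> 0" using insert.IH by simp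
    qed simp
    then have "AE f in distr M ?P ?Y. AE g in distr M ?N ?Z. det (?B f (g i)) \<noteq> 0"
    proof eventually_elim
      case (elim f)
      \<comment> \<open>Putting the basis vector back into row \<open>i\<close> restores the
        previous matrix, whose nonzero determinant becomes the slope in \<open>lin\<close>.\<close>
      have e: "?B f (axis i 1) = ?A J f" using insert.hyps by (auto simp: vec_eq_iff)
      have lin: "det (?B f (x + t *\<^sub>R axis i 1)) = det (?B f x) + t * det (?A J f)" for x t
        using det_row_mul[of i t "\<lambda>_. axis i 1" "\<lambda>k. if k \<in> J then f k else axis k 1"]
        unfolding scalar_mult_eq_scaleR by (simp add: det_row_add flip: e)
      have cont: "continuous_on UNIV (\<lambda>x. det (?B f x))"
      proof (rule continuous_on_det)
        fix k l show "continuous_on UNIV (\<lambda>x. ?B f x $ k $ l)"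
          by (cases "k = i") (auto intro!: continuous_intros)
      qed
      have "AE x in distr M borel (X i). det (?B f x) \<noteq> 0"
      proof (rule AE_absolutely_continuous_lborel[OF D, where w = "axis i 1"])
        fix x
        have "{t. \<not> det (?B f (x + t *\<^sub>R axis i 1)) \<noteq> 0} \<subseteq> {- det (?B f x) / det (?A J f)}"
          using elim by (auto simp: lin field_simps eq_neg_iff_add_eq_0)
        then show "finite {t. \<not> det (?B f (x + t *\<^sub>R axis i 1)) \<noteq> 0}"
          by (rule finite_subset) simp
        have "closed {x. det (?B f x) = 0}" using cont by (intro closed_Collect_eq) simp_all
        then show "{x. \<not> det (?B f x) \<noteq> 0} \<in> sets borel" by simp
      qed simp
      then have "AE \<omega> in M. det (?B f (?Z \<omega> i)) \<noteq> 0"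
        using AE_distrD[OF X] by (simp cong: if_cong)
      moreover have "(\<lambda>g. det (?B f (g i))) \<in> borel_measurable ?N"
        by (rule measurable_compose[OF _ borel_measurable_continuous_onI[OF cont]]) simp
      then have "{g \<in> space ?N. det (?B f (g i)) \<noteq> 0} \<in> sets ?N" by measurable
      ultimately show ?case by (simp add: AE_distr_iff)
    qed
    then have "AE z in distr M ?P ?Y \<Otimes>\<^sub>M distr M ?N ?Z. det (?B (fst z) (snd z i)) \<noteq> 0"
      using set by (intro AE_pair_measure) (simp_all cong: if_cong)
    then have "AE z in distr M (?P \<Otimes>\<^sub>M ?N) (\<lambda>\<omega>. (?Y \<omega>, ?Z \<omega>)). det (?B (fst z) (snd z i)) \<noteq> 0"
      by (simp only: eq)
    then have "AE \<omega> in M. det (?B (fst (?Y \<omega>, ?Z \<omega>)) (snd (?Y \<omega>, ?Z \<omega>) i)) \<noteq> 0"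
      by (rule AE_distrD[rotated]) measurable
    moreover have "?B (fst (?Y \<omega>, ?Z \<omega>)) (snd (?Y \<omega>, ?Z \<omega>) i) = ?A (insert i J) (\<lambda>k. X k \<omega>)" for \<omega>
      by (auto simp: vec_eq_iff)
    ultimately show ?case by simp
  qed
  from this[of UNIV] show ?thesis by simp
qed

section \<open>The two optimization steps\<close>

lemma transpose_left_inverse:
  fixes U :: "real^'r^'n"
  assumes "L ** U = mat 1"
  shows "transpose U ** transpose L = mat 1"
  using assms by (metis matrix_transpose_mul transpose_mat)

text \<open>\<open>is_arg_min\<close> says that no feasible point is strictly better; in the linear
  order of the reals this is a lower bound over all feasible points.\<close>

lemma step2_opt_iff:
  fixes U1 :: "real^'r^'n1" and U2 :: "real^'r^'n2"
  shows "step2_opt B U1 U2 S \<longleftrightarrow> B = U1 ** S ** transpose U2 \<and> col_stochastic U1 \<and> col_stochastic U2 \<and>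
    (\<forall>(V1 :: real^'r^'n1) (V2 :: real^'r^'n2) S'. B = V1 ** S' ** transpose V2 \<longrightarrow>
      col_stochastic V1 \<longrightarrow> col_stochastic V2 \<longrightarrow>
      \<bar>det S\<bar> \<le> \<bar>det S'\<bar>)"
  unfolding step2_opt_def is_arg_min_def split_paired_Ex prod.case not_ex de_Morgan_conj not_less imp_conv_disj
  by (simp only: conj_assoc disj_assoc)

lemma step3_opt_iff:
  fixes G :: "real^'r^'m" and U :: "real^'r^'n"
  shows "step3_opt B G U \<longleftrightarrow> B = G ** transpose U \<and> col_stochastic U \<and>
    (\<forall>(G' :: real^'r^'m) (U' :: real^'r^'n). B = G' ** transpose U' \<longrightarrow> col_stochastic U' \<longrightarrow>
      det (transpose G ** G) \<le> det (transpose G' ** G'))"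
  unfolding step3_opt_def is_arg_min_def split_paired_Ex prod.case not_ex de_Morgan_conj not_less imp_conv_disj
  by (simp only: conj_assoc disj_assoc)

lemma step2_opt_permutation:
  fixes U1 :: "real^'r^'n1" and U2 :: "real^'r^'n2" and R :: "real^'r^'r"
  assumes U1: "SSC U1" "transpose U1 *v 1 = 1" and U2: "SSC U2" "transpose U2 *v 1 = 1"
    and R: "det R \<noteq> 0" and opt: "step2_opt (U1 ** R ** transpose U2) V1 V2 S"
  obtains P1 P2 where "permutation_matrix P1" "permutation_matrix P2"
    "V1 = U1 ** P1" "V2 = U2 ** P2"
proof -
  have eq: "U1 ** R ** transpose U2 = V1 ** S ** transpose V2"
    and V: "col_stochastic V1" "col_stochastic V2"
    using opt unfolding step2_opt_iff by blast+
  have "col_stochastic U1" "col_stochastic U2"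
    using U1 U2 by (simp_all add: col_stochastic_def SSC_def)
  \<comment> \<open>The true factors with core \<open>R\<close> are feasible.\<close>
  then have min: "\<bar>det S\<bar> \<le> \<bar>det R\<bar>"
    using opt unfolding step2_opt_iff by blast
  obtain L1 where L1: "L1 ** U1 = mat 1" by (rule SSC_left_invertible[OF U1(1)])
  obtain L2 where L2: "L2 ** U2 = mat 1" by (rule SSC_left_invertible[OF U2(1)])
  obtain R' where R': "R ** R' = mat 1" "R' ** R = mat 1"
    using R by (auto simp: invertible_det_nz[symmetric] invertible_def)
  \<comment> \<open>A right inverse of \<open>R ** transpose U2\<close> lets \<open>V1\<close>
    factor through \<open>U1\<close>. The transposed equation below does the same for
    \<open>V2\<close>.\<close>
  have "R ** transpose U2 ** (transpose L2 ** R') = R ** (transpose U2 ** transpose L2) ** R'"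
    by (simp add: matrix_mul_assoc)
  then have Y1: "R ** transpose U2 ** (transpose L2 ** R') = mat 1"
    by (simp add: transpose_left_inverse[OF L2] R')
  have "U1 ** (R ** transpose U2) = V1 ** (S ** transpose V2)"
    using eq by (simp add: matrix_mul_assoc)
  then obtain Q1 where Q1: "V1 = U1 ** Q1"
    using matrix_factor_through L1 Y1 by metis
  have "transpose R ** transpose U1 ** (transpose L1 ** transpose R')
      = transpose R ** (transpose U1 ** transpose L1) ** transpose R'"
    by (simp add: matrix_mul_assoc)
  then have Y2: "transpose R ** transpose U1 ** (transpose L1 ** transpose R') = mat 1"
    by (simp add: transpose_left_inverse[OF L1] transpose_left_inverse[OF R'(2)])
  have "U2 ** (transpose R ** transpose U1) = V2 ** (transpose S ** transpose V1)"
    using arg_cong[OF eq, of transpose] by (simp add: matrix_transpose_mul matrix_mul_assoc)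
  then obtain Q2 where Q2: "V2 = U2 ** Q2"
    using matrix_factor_through L2 Y2 by metis
  have "R = (L1 ** U1) ** R ** (transpose U2 ** transpose L2)"
    by (simp add: L1 transpose_left_inverse[OF L2])
  also have "\<dots> = L1 ** (U1 ** R ** transpose U2) ** transpose L2"
    by (simp add: matrix_mul_assoc)
  also have "\<dots> = (L1 ** U1) ** Q1 ** S ** transpose Q2 ** (transpose U2 ** transpose L2)"
    unfolding eq by (simp add: Q1 Q2 matrix_transpose_mul matrix_mul_assoc)
  also have "\<dots> = Q1 ** S ** transpose Q2"
    by (simp add: L1 transpose_left_inverse[OF L2])
  finally have RS: "\<bar>det R\<bar> = \<bar>det Q1\<bar> * \<bar>det Q2\<bar> * \<bar>det S\<bar>"
    by (simp add: det_mul det_transpose abs_mult)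
  \<comment> \<open>Invertibility of \<open>R\<close> forces \<open>det S \<noteq> 0\<close>, so
    \<open>\<bar>det S\<bar>\<close> can be cancelled in \<open>min\<close>.\<close>
  with R have "\<bar>det S\<bar> > 0" by auto
  with min have ge: "1 \<le> \<bar>det Q1\<bar> * \<bar>det Q2\<bar>" unfolding RS by simp
  have c1: "0 \<le> U1 ** Q1" "transpose Q1 *v 1 = 1" and c2: "0 \<le> U2 ** Q2" "transpose Q2 *v 1 = 1"
    using V U1(2) U2(2) col_stochastic_factor unfolding Q1 Q2 by (auto simp: col_stochastic_def)
  have le: "\<bar>det Q1\<bar> \<le> 1" "\<bar>det Q2\<bar> \<le> 1"
    using SSC_factor_permutation(1) U1(1) U2(1) c1 c2 by blast+
  have "1 \<le> \<bar>det Q1\<bar>" using mult_left_mono[OF le(2), of "\<bar>det Q1\<bar>"] ge by simp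
  moreover have "1 \<le> \<bar>det Q2\<bar>" using mult_right_mono[OF le(1), of "\<bar>det Q2\<bar>"] ge by simp
  ultimately have "permutation_matrix Q1" "permutation_matrix Q2"
    using SSC_factor_permutation(2) U1(1) U2(1) c1 c2 by blast+
  then show ?thesis using that Q1 Q2 by blast
qed

text \<open>The Gram determinants of \<open>G\<close> and \<open>G'\<close> differ by the factor
  \<open>(det Q)^2\<close>. The left inverse of \<open>G\<close> keeps them positive, so optimality
  forces \<open>\<bar>det Q\<bar> \<ge> 1\<close>.\<close>

lemma step3_opt_permutation:
  fixes U V :: "real^'r^'n" and G G' :: "real^'r^'m"
  assumes U: "SSC U" "transpose U *v 1 = 1" and L: "L ** G = mat 1"
    and opt: "step3_opt (G ** transpose U) G' V"
  obtains P where "permutation_matrix P" "V = U ** P" "G = G' ** transpose P"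
proof -
  have eq: "G ** transpose U = G' ** transpose V" and V: "col_stochastic V"
    using opt unfolding step3_opt_iff by blast+
  have "col_stochastic U" using U by (simp add: col_stochastic_def SSC_def)
  then have min: "det (transpose G' ** G') \<le> det (transpose G ** G)"
    using opt unfolding step3_opt_iff by blast
  obtain LU where LU: "LU ** U = mat 1" by (rule SSC_left_invertible[OF U(1)])
  have "U ** transpose G = V ** transpose G'"
    using arg_cong[OF eq, of transpose] by (simp add: matrix_transpose_mul)
  then obtain Q where Q: "V = U ** Q" "invertible Q"
    by (rule matrix_factor_through[OF _ LU transpose_left_inverse[OF L]])
  have "G = G ** transpose U ** transpose LU"
    using transpose_left_inverse[OF LU] by (simp flip: matrix_mul_assoc)
  also have "\<dots> = G' ** transpose Q ** (transpose U ** transpose LU)"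
    unfolding eq by (simp add: Q matrix_transpose_mul matrix_mul_assoc)
  finally have GQ: "G = G' ** transpose Q" by (simp add: transpose_left_inverse[OF LU])
  have "transpose G ** G = Q ** (transpose G' ** G') ** transpose Q"
    unfolding GQ by (simp add: matrix_transpose_mul matrix_mul_assoc)
  then have det: "det (transpose G ** G) = (det Q)\<^sup>2 * det (transpose G' ** G')"
    by (simp add: det_mul det_transpose power2_eq_square)
  have "det (transpose G ** G) > 0" using L by (rule gram_det_pos)
  then have "det (transpose G' ** G') > 0"
    unfolding det by (simp add: zero_less_mult_iff)
  then have "1 \<le> (det Q)\<^sup>2" using min unfolding det by simp
  then have "1 \<le> \<bar>det Q\<bar>" using abs_le_square_iff[of 1 "det Q"] by simp
  moreover have "0 \<le> U ** Q" "transpose Q *v 1 = 1"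
    using V U(2) col_stochastic_factor unfolding Q(1) by (auto simp: col_stochastic_def)
  ultimately have "permutation_matrix Q" using SSC_factor_permutation(2) U(1) by blast
  then show ?thesis using that Q(1) GQ by blast
qed

section \<open>Recovery for a fixed nonsingular draw\<close>

lemma procedure_output_permutation:
  fixes U1 :: "real^'r^'n1" and U2 :: "real^'r^'n2" and U3 :: "real^'r3^'n3"
    and G :: "real^'r3^'r^'r" and a :: "'n3 \<Rightarrow> real^'n3"
  assumes U1: "SSC U1" "transpose U1 *v 1 = 1" and U2: "SSC U2" "transpose U2 *v 1 = 1"
    and U3: "SSC U3" "transpose U3 *v 1 = 1" and rank: "rank (unfold3 G) = CARD('r3)"
    and R: "det (slice_comb G (transpose U3 *v a i1)) \<noteq> 0" and a: "det (\<chi> i. a i) \<noteq> 0"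
    and out: "procedure_output (tucker U1 U2 U3 G) a i1 V1 V2 V3 G'"
  shows "\<exists>P1 P2 P3. permutation_matrix P1 \<and> permutation_matrix P2 \<and> permutation_matrix P3 \<and>
         U1 = V1 ** P1 \<and> U2 = V2 ** P2 \<and> U3 = V3 ** P3 \<and>
         G = tucker (transpose P1) (transpose P2) (transpose P3) G'"
proof -
  define A :: "real^'n3^'n3" where "A = (\<chi> j i. a i $ j)"
  define S :: "real^'n3^('r \<times> 'r)" where
    "S = (\<chi> p i. vectorize (pinv V1 ** slice_comb (tucker U1 U2 U3 G) (a i) ** pinv (transpose V2)) $ p)"
  obtain S1 where "step2_opt (slice_comb (tucker U1 U2 U3 G) (a i1)) V1 V2 S1"
    using out unfolding procedure_output_def Let_def by blast
  then obtain P1 P2 where P: "permutation_matrix P1" "permutation_matrix P2"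
    and V: "V1 = U1 ** P1" "V2 = U2 ** P2"
    unfolding slice_comb_tucker by (rule step2_opt_permutation[OF U1 U2 R])
  have step3: "step3_opt (S ** matrix_inv A) (unfold3 G') V3"
    using out unfolding procedure_output_def Let_def S_def A_def by blast
  note orth1 = permutation_matrix_orthogonal[OF P(1)] and orth2 = permutation_matrix_orthogonal[OF P(2)]
  have UV: "U1 = V1 ** transpose P1" "U2 = V2 ** transpose P2"
    by (simp_all add: V orth1 orth2 flip: matrix_mul_assoc)
  obtain L1 where L1: "L1 ** U1 = mat 1" by (rule SSC_left_invertible[OF U1(1)])
  have "transpose P1 ** L1 ** V1 = transpose P1 ** (L1 ** U1) ** P1"
    unfolding V matrix_mul_assoc by (rule refl)
  then have "transpose P1 ** L1 ** V1 = mat 1" by (simp add: L1 orth1)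
  then have V1: "pinv V1 ** V1 = mat 1" by (rule pinv_of_left_invertible)
  obtain L2 where L2: "L2 ** U2 = mat 1" by (rule SSC_left_invertible[OF U2(1)])
  have "transpose P2 ** L2 ** V2 = transpose P2 ** (L2 ** U2) ** P2"
    unfolding V matrix_mul_assoc by (rule refl)
  then have "transpose P2 ** L2 ** V2 = mat 1" by (simp add: L2 orth2)
  then have V2: "transpose V2 ** pinv (transpose V2) = mat 1"
    by (rule pinv_of_left_invertible)
  \<comment> \<open>The true core rewritten for the computed factors: \<open>T\<close> is also the
    Tucker product of \<open>V1\<close>, \<open>V2\<close>, \<open>U3\<close> and
    \<open>H\<close>.\<close>
  define H where "H = tucker (transpose P1) (transpose P2) (mat 1) G"
  have S: "S = unfold3 H ** transpose U3 ** A"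
  proof -
    have "pinv V1 ** slice_comb (tucker U1 U2 U3 G) x ** pinv (transpose V2)
        = slice_comb (tucker (mat 1) (mat 1) U3 H) x" for x
    proof -
      have "pinv V1 ** slice_comb (tucker U1 U2 U3 G) x ** pinv (transpose V2)
        = (pinv V1 ** V1) ** (transpose P1 ** slice_comb G (transpose U3 *v x) ** P2) ** (transpose V2 ** pinv (transpose V2))"
        unfolding slice_comb_tucker
        by (subst UV(1), subst UV(2)) (simp only: matrix_transpose_mul transpose_transpose matrix_mul_assoc)
      also have "\<dots> = slice_comb (tucker (mat 1) (mat 1) U3 H) x"
        by (simp add: V1 V2 H_def tucker_tucker slice_comb_tucker)
      finally show ?thesis .
    qed
    then have "S $ p $ i = ((unfold3 H ** transpose U3) *v a i) $ p" for p i
      by (simp only: S_def unfold3_mult flip: unfold3_tucker_third) simp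
    then have "S $ p $ i = (unfold3 H ** transpose U3 ** A) $ p $ i" for p i
      by (simp only: A_def matrix_matrix_mult_def matrix_vector_mult_def vec_lambda_beta)
    then show ?thesis unfolding vec_eq_iff by blast
  qed
  \<comment> \<open>The draws are the columns of \<open>A\<close> but the rows of the matrix in the
    hypothesis.\<close>
  have "transpose A = (\<chi> i. a i)" unfolding A_def transpose_def by (simp add: vec_eq_iff)
  then have "det A \<noteq> 0" using a det_transpose[of A] by simp
  then have "invertible A" by (simp add: invertible_det_nz)
  then have "A ** matrix_inv A = mat 1"
    unfolding invertible_def matrix_inv_def by (rule someI_ex[THEN conjunct1])
  then have "S ** matrix_inv A = unfold3 H ** transpose U3"
    unfolding S by (simp flip: matrix_mul_assoc)
  then have opt: "step3_opt (unfold3 H ** transpose U3) (unfold3 G') V3" using step3 by (simp only:)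
  have GH: "G = tucker P1 P2 (mat 1) H"
    unfolding H_def tucker_tucker by (simp only: orth1 orth2 matrix_mul_rid tucker_mat_1)
  \<comment> \<open>\<open>G\<close> and \<open>H\<close> differ by permutations of the first two
    modes, so the unfolding of \<open>H\<close> inherits full column rank.\<close>
  have "v = 0" if "unfold3 H *v v = 0" for v
  proof -
    have "slice_comb G v = P1 ** slice_comb H v ** transpose P2"
      by (subst GH) (simp add: slice_comb_tucker transpose_mat)
    moreover have "slice_comb H v = 0" using that by (simp add: unfold3_mult vectorize_eq_0)
    ultimately have "unfold3 G *v v = 0" by (simp add: unfold3_mult vectorize_eq_0)
    then show ?thesis using rank by (simp add: full_rank_injective vec.inj_iff_eq_0)
  qed
  then obtain L where "L ** unfold3 H = mat 1" using matrix_left_invertible_ker[of "unfold3 H"] by blast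
  then obtain P3 where P3: "permutation_matrix P3" "V3 = U3 ** P3" "unfold3 H = unfold3 G' ** transpose P3"
    using opt by (rule step3_opt_permutation[OF U3])
  have "H = tucker (mat 1) (mat 1) P3 G'"
    using P3(3) by (simp only: unfold3_inject flip: unfold3_tucker_third)
  then have "G = tucker P1 P2 P3 G'" unfolding GH by (simp only: tucker_tucker matrix_mul_rid matrix_mul_lid)
  moreover have "U3 = V3 ** transpose P3"
    by (simp add: P3(2) permutation_matrix_orthogonal[OF P3(1)] flip: matrix_mul_assoc)
  \<comment> \<open>Both steps give \<open>V = U ** P\<close>; solving for the true factors
    transposes the permutations.\<close>
  ultimately show ?thesis
    using P P3(1) UV
    by - (rule exI[of _ "transpose P1"], rule exI[of _ "transpose P2"], rule exI[of _ "transpose P3"],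
        simp add: permutation_matrix_transpose)
qed

section \<open>Almost sure nonsingularity and the final result\<close>

lemma AE_det_slice_comb:
  fixes U :: "real^'r3^'n3" and G :: "real^'r3^'r^'r"
  assumes D: "absolutely_continuous lborel D" "sets D = sets borel"
    and U: "L ** U = mat 1" and v: "det (slice_comb G v) \<noteq> 0"
  shows "AE x in D. det (slice_comb G (transpose U *v x)) \<noteq> 0"
proof (rule AE_absolutely_continuous_lborel[OF D, where w = "transpose L *v v"])
  \<comment> \<open>The direction is a preimage of \<open>v\<close>, so along it the matrix is a
    pencil with nonsingular leading coefficient \<open>slice_comb G v\<close>.\<close>
  have "transpose U *v (transpose L *v v) = v"
    by (metis matrix_vector_mul_assoc matrix_vector_mul_lid transpose_left_inverse[OF U])
  then show "finite {t. \<not> det (slice_comb G (transpose U *v (x + t *\<^sub>R (transpose L *v v)))) \<noteq> 0}" for x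
    using finite_det_pencil_zeros[OF v]
    by (simp add: matrix_vector_right_distrib matrix_vector_mult_scaleR slice_comb_add slice_comb_scaleR
        del: transpose_matrix_vector)
  have "continuous_on UNIV (\<lambda>x. det (slice_comb G (transpose U *v x)))"
    by (intro continuous_on_det) (auto simp: slice_comb_nth matrix_vector_mult_def intro!: continuous_intros)
  then have "closed {x. det (slice_comb G (transpose U *v x)) = 0}" by (intro closed_Collect_eq) simp_all
  then show "{x. \<not> det (slice_comb G (transpose U *v x)) \<noteq> 0} \<in> sets borel" by simp
qed

text \<open>All outputs are quantified inside the almost-everywhere statement: the exceptional set
  depends on the draws alone, not on which optimal solutions are chosen.\<close>

theorem theorem5p18:
  fixes T :: "real^'n3^'n2^'n1"
    and U1 :: "real^'r^'n1" and U2 :: "real^'r^'n2" and U3 :: "real^'r3^'n3"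
    and G :: "real^'r3^'r^'r"
    and M :: "'w measure" and D :: "(real^'n3) measure"
    and \<alpha> :: "'n3 \<Rightarrow> 'w \<Rightarrow> real^'n3" and i1 :: 'n3
  assumes "T = tucker U1 U2 U3 G"
    and "0 \<le> U1" and "0 \<le> U2" and "0 \<le> U3"
    and "transpose U1 *v 1 = 1" and "transpose U2 *v 1 = 1" and "transpose U3 *v 1 = 1"
    and "sqrt (real CARD('r3)) \<le> real CARD('r)"
    and "SSC U1" and "SSC U2" and "SSC U3"
    and "rank (unfold3 G) = CARD('r3)"
    and "\<exists>V \<in> {\<Sum>k\<in>UNIV. v $ k *\<^sub>R slice3 G k | v. 0 \<le> v}. rank V = CARD('r)"
    and "prob_space M"
    and "prob_space.indep_vars M (\<lambda>_. borel) \<alpha> UNIV"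
    and "\<And>i. distr M borel (\<alpha> i) = D"
    and "absolutely_continuous lborel D"
  shows "AE \<omega> in M. \<forall>V1 V2 V3 G'.
    procedure_output T (\<lambda>i. \<alpha> i \<omega>) i1 V1 V2 V3 G' \<longrightarrow>
      (\<exists>P1 P2 P3. permutation_matrix P1 \<and> permutation_matrix P2 \<and> permutation_matrix P3 \<and>
         U1 = V1 ** P1 \<and> U2 = V2 ** P2 \<and> U3 = V3 ** P3 \<and>
         G = tucker (transpose P1) (transpose P2) (transpose P3) G')"
proof -
  interpret prob_space M by fact
  have \<alpha>: "\<alpha> i \<in> borel_measurable M" for i
    using assms(15) by (auto simp: indep_vars_def)
  obtain v where "rank (slice_comb G v) = CARD('r)"
    using assms(13) by (auto simp: slice_comb_def)
  then have v: "det (slice_comb G v) \<noteq> 0"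
    by (simp add: full_rank_injective flip: invertible_det_nz invertible_left_inverse matrix_left_invertible_injective)
  obtain L where "L ** U3 = mat 1" using assms(11) by (rule SSC_left_invertible)
  moreover have "sets D = sets borel" by (simp flip: assms(16)[of i1])
  ultimately have "AE x in D. det (slice_comb G (transpose U3 *v x)) \<noteq> 0"
    using assms(17) v by (intro AE_det_slice_comb)
  then have "AE x in distr M borel (\<alpha> i1). det (slice_comb G (transpose U3 *v x)) \<noteq> 0"
    by (simp only: assms(16))
  then have "AE \<omega> in M. det (slice_comb G (transpose U3 *v \<alpha> i1 \<omega>)) \<noteq> 0"
    by (rule AE_distrD[OF \<alpha>])
  moreover have "AE \<omega> in M. det (\<chi> i. \<alpha> i \<omega>) \<noteq> 0"
    using assms(15-17) by (intro AE_det_of_independent_rows) simp_all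
  ultimately show ?thesis
  proof eventually_elim
    case (elim \<omega>)
    show ?case
      unfolding assms(1)
      by (intro allI impI procedure_output_permutation[OF assms(9,5,10,6,11,7,12)]) (rule elim | assumption)+
  qed
qed

end
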